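(* For $n\geq 6$ and $n-1\leq m<\binom{n}{2}-6$, there does not exist an optimal graph in $\mathcal{G}_{n,m}$ for the domination polynomial.
   Context: All graphs are finite and simple. A set $S$ of vertices of a graph $G$ is dominating if every vertex of $G$ is in $S$ or adjacent to a vertex of $S$. The domination polynomial is $D(G,x)=\sum_{i=1}^{|V(G)|} d(G,i)x^i$, where $d(G,i)$ is the number of dominating sets of $G$ of cardinality $i$. $\mathcal{G}_{n,m}$ denotes the set of simple graphs with $n$ vertices and $m$ edges. A graph $H\in\mathcal{G}_{n,m}$ is optimal if $D(H,x)\geq D(G,x)$ for all $G\in\mathcal{G}_{n,m}$ and all $x\geq 0$. *)

theory Defs
  imports Complex_Main "HOL-Computational_Algebra.Polynomial"
begin

record 'a sgraph =
  verts :: "'a set"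
  edges :: "'a set set"

definition simple_graph :: "'a sgraph \<Rightarrow> bool" where
  "simple_graph G \<longleftrightarrow>
     finite (verts G) \<and> (\<forall>e\<in>edges G. e \<subseteq> verts G \<and> card e = 2)"

definition graph_class :: "nat \<Rightarrow> nat \<Rightarrow> 'a sgraph set" where
  "graph_class n m = {G. simple_graph G \<and> card (verts G) = n \<and> card (edges G) = m}"

definition adjacent :: "'a sgraph \<Rightarrow> 'a \<Rightarrow> 'a \<Rightarrow> bool" where
  "adjacent G u v \<longleftrightarrow> {u, v} \<in> edges G"

definition dominating :: "'a sgraph \<Rightarrow> 'a set \<Rightarrow> bool" where
  "dominating G S \<longleftrightarrow>
     S \<subseteq> verts G \<and> (\<forall>v\<in>verts G. v \<in> S \<or> (\<exists>u\<in>S. adjacent G v u))"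

definition num_dominating :: "'a sgraph \<Rightarrow> nat \<Rightarrow> nat" where
  "num_dominating G i = card {S. dominating G S \<and> card S = i}"

definition domination_poly :: "'a sgraph \<Rightarrow> real poly" where
  "domination_poly G =
     (\<Sum>i = 1..card (verts G). monom (of_nat (num_dominating G i)) i)"

definition optimal :: "nat \<Rightarrow> nat \<Rightarrow> 'a sgraph \<Rightarrow> bool" where
  "optimal n m H \<longleftrightarrow> H \<in> graph_class n m \<and>
     (\<forall>G\<in>(graph_class n m :: 'a sgraph set). \<forall>x\<ge>0.
        poly (domination_poly H) x \<ge> poly (domination_poly G) x)"

end

theory Submission
  imports Defs
begin

text \<open>
  Near \<open>x = 0\<close> an optimal graph \<open>H\<close> must maximise the number of universal vertices. If \<open>K\<close> is
  the set of universal vertices and \<open>W\<close> its complement, then \<open>W\<close> spans at most \<open>card W - 2\<close>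
  edges, since otherwise one more universal vertex could be afforded; moreover \<open>K\<close> is nonempty and
  \<open>card W \<ge> 5\<close>. For large \<open>x\<close>, if all closed neighbourhoods in the graphs involved have at least
  \<open>s\<close> elements, then \<open>H\<close> must minimise the number of distinct closed neighbourhoods of size
  \<open>s\<close>, as the sets of size \<open>n - s\<close> that fail to dominate are exactly their complements.
  The two demands conflict: edges at a universal vertex can be traded for edges inside \<open>W\<close> so
  that this number drops. Replacing one edge excludes isolated vertices of the graph spanned by
  \<open>W\<close> and leaves with a neighbour of degree at least 2; so all leaves lie in \<open>K\<^sub>2\<close> components,
  of which there are at least two, and replacing three edges turns two of them into \<open>K\<^sub>4\<close> minus
  an edge.
\<close>

section \<open>Closed neighbourhoods and pairs of vertices\<close>

definition closed_nbhd :: "'a sgraph \<Rightarrow> 'a \<Rightarrow> 'a set" where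
  "closed_nbhd G v = {u \<in> verts G. u = v \<or> {u, v} \<in> edges G}"

text \<open>A set of sets rather than of vertices: vertices sharing a closed neighbourhood count
  once. The exchange arguments hinge on this.\<close>

definition small_nbhds :: "'a sgraph \<Rightarrow> nat \<Rightarrow> 'a set set" where
  "small_nbhds G s = closed_nbhd G ` {v \<in> verts G. card (closed_nbhd G v) = s}"

definition pairs :: "'a set \<Rightarrow> 'a set set" where
  "pairs V = {e. e \<subseteq> V \<and> card e = 2}"

lemma finite_pairs: "finite V \<Longrightarrow> finite (pairs V)"
  by (rule finite_subset[of _ "Pow V"]) (auto simp: pairs_def)

lemma card_pairs: "finite V \<Longrightarrow> card (pairs V) = card V choose 2"
  unfolding pairs_def by (rule n_subsets)

lemma doubleton_in_pairs: "{x, y} \<in> pairs V \<longleftrightarrow> x \<in> V \<and> y \<in> V \<and> x \<noteq> y"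
  by (auto simp: pairs_def card_2_iff doubleton_eq_iff)

lemma graph_class_iff:
  "G \<in> graph_class n m \<longleftrightarrow>
     finite (verts G) \<and> edges G \<subseteq> pairs (verts G) \<and> card (verts G) = n \<and> card (edges G) = m"
  by (auto simp: graph_class_def simple_graph_def pairs_def)

lemma closed_nbhd_subset: "closed_nbhd G v \<subseteq> verts G"
  by (auto simp: closed_nbhd_def)

section \<open>Dominating sets counted through their complements\<close>

lemma dominating_iff_closed_nbhd:
  "dominating G S \<longleftrightarrow> S \<subseteq> verts G \<and> (\<forall>v\<in>verts G. closed_nbhd G v \<inter> S \<noteq> {})"
  unfolding dominating_def closed_nbhd_def adjacent_def
  by (auto simp: insert_commute)

text \<open>A set fails to dominate \<open>v\<close> exactly when its complement contains the closed
  neighbourhood of \<open>v\<close>.\<close>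

lemma num_dominating_compl:
  assumes "finite (verts G)" "i \<le> card (verts G)"
  shows "num_dominating G (card (verts G) - i) =
    card {T. T \<subseteq> verts G \<and> card T = i \<and> (\<forall>v\<in>verts G. \<not> closed_nbhd G v \<subseteq> T)}"
    (is "_ = card ?T")
proof -
  have "bij_betw (\<lambda>T. verts G - T) ?T {S. dominating G S \<and> card S = card (verts G) - i}"
  proof (rule bij_betw_byWitness[where f' = "\<lambda>T. verts G - T"])
    show "(\<lambda>T. verts G - T) ` ?T \<subseteq> {S. dominating G S \<and> card S = card (verts G) - i}"
      using assms closed_nbhd_subset[of G]
      by (fastforce simp: dominating_iff_closed_nbhd card_Diff_subset finite_subset)
    show "(\<lambda>T. verts G - T) ` {S. dominating G S \<and> card S = card (verts G) - i} \<subseteq> ?T"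
      using assms closed_nbhd_subset[of G]
      by (auto simp: dominating_iff_closed_nbhd card_Diff_subset finite_subset)
  qed (auto simp: dominating_iff_closed_nbhd)
  then show ?thesis
    unfolding num_dominating_def by (simp add: bij_betw_same_card)
qed

text \<open>A set with fewer than \<open>s\<close> elements is too small to contain any closed
  neighbourhood, so each of its complements dominates.\<close>

lemma num_dominating_large:
  assumes "finite (verts G)" "\<forall>v\<in>verts G. s \<le> card (closed_nbhd G v)" "i < s" "i \<le> card (verts G)"
  shows "num_dominating G (card (verts G) - i) = card (verts G) choose i"
proof -
  have "\<not> closed_nbhd G v \<subseteq> T" if "T \<subseteq> verts G" "card T = i" "v \<in> verts G" for T v
    using that assms card_mono[of T "closed_nbhd G v"] finite_subset[of T "verts G"] by force
  then have "{T. T \<subseteq> verts G \<and> card T = i \<and> (\<forall>v\<in>verts G. \<not> closed_nbhd G v \<subseteq> T)} =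
      {T. T \<subseteq> verts G \<and> card T = i}"
    by auto
  then show ?thesis
    by (simp add: num_dominating_compl[OF assms(1,4)] n_subsets[OF assms(1)])
qed

text \<open>By minimality of \<open>s\<close>, a set of size \<open>s\<close> containing a closed
  neighbourhood equals it; hence each failure to dominate corresponds to one member of
  \<open>small_nbhds G s\<close>.\<close>

lemma num_dominating_critical:
  assumes "finite (verts G)" "\<forall>v\<in>verts G. s \<le> card (closed_nbhd G v)" "s \<le> card (verts G)"
  shows "num_dominating G (card (verts G) - s) + card (small_nbhds G s) = card (verts G) choose s"
proof -
  let ?A = "{T. T \<subseteq> verts G \<and> card T = s \<and> (\<forall>v\<in>verts G. \<not> closed_nbhd G v \<subseteq> T)}"
  have eq: "closed_nbhd G v = T"
    if "T \<subseteq> verts G" "card T = s" "v \<in> verts G" "closed_nbhd G v \<subseteq> T" for T v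
    using that assms card_seteq[of T "closed_nbhd G v"] finite_subset[of T "verts G"] by auto
  have "?A \<union> small_nbhds G s = {T. T \<subseteq> verts G \<and> card T = s}"
  proof (intro equalityI subsetI)
    fix T assume T: "T \<in> {T. T \<subseteq> verts G \<and> card T = s}"
    show "T \<in> ?A \<union> small_nbhds G s"
    proof (cases "\<exists>v\<in>verts G. closed_nbhd G v \<subseteq> T")
      case True
      then obtain v where v: "v \<in> verts G" "closed_nbhd G v \<subseteq> T" by blast
      then have "closed_nbhd G v = T" using eq[of T v] T by blast
      then show ?thesis using v T by (auto simp: small_nbhds_def)
    qed (use T in auto)
  next
    fix T assume "T \<in> ?A \<union> small_nbhds G s"
    then show "T \<in> {T. T \<subseteq> verts G \<and> card T = s}"
      using closed_nbhd_subset[of G] by (auto simp: small_nbhds_def)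
  qed
  moreover have "?A \<inter> small_nbhds G s = {}"
    by (auto simp: small_nbhds_def)
  moreover have "finite ?A" "finite (small_nbhds G s)"
    using assms(1) by (auto simp: small_nbhds_def)
  ultimately have "card ?A + card (small_nbhds G s) = card {T. T \<subseteq> verts G \<and> card T = s}"
    using card_Un_disjoint[of ?A "small_nbhds G s"] by simp
  then show ?thesis
    by (simp add: num_dominating_compl[OF assms(1,3)] n_subsets[OF assms(1)])
qed

section \<open>Necessary conditions for optimality, from large x and from x near 0\<close>

lemma coeff_domination_poly:
  "coeff (domination_poly G) i =
     (if 1 \<le> i \<and> i \<le> card (verts G) then of_nat (num_dominating G i) else 0)"
  unfolding domination_poly_def by (simp add: coeff_sum)

lemma optimal_poly_diff_le:
  fixes G H :: "'a sgraph"
  shows "optimal n m H \<Longrightarrow> G \<in> graph_class n m \<Longrightarrow> 0 \<le> x \<Longrightarrow>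
    poly (domination_poly G - domination_poly H) x \<le> 0"
  by (auto simp: optimal_def)

text \<open>The two polynomials agree in all degrees above \<open>n - s\<close>, so the coefficient
  there decides for large x. The bound \<open>s < n\<close> keeps this degree positive, where
  coefficients do count dominating sets.\<close>

lemma optimal_small_nbhds_le:
  fixes G H :: "'a sgraph"
  assumes opt: "optimal n m H" and G: "G \<in> graph_class n m" and "s < n"
    and sG: "\<forall>v\<in>verts G. s \<le> card (closed_nbhd G v)"
    and sH: "\<forall>v\<in>verts H. s \<le> card (closed_nbhd H v)"
  shows "card (small_nbhds H s) \<le> card (small_nbhds G s)"
proof (rule ccontr)
  assume "\<not> ?thesis"
  then have less: "card (small_nbhds G s) < card (small_nbhds H s)" by simp
  have H: "H \<in> graph_class n m" using opt by (simp add: optimal_def)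
  have fin: "finite (verts G)" "finite (verts H)" and n: "card (verts G) = n" "card (verts H) = n"
    using G H by (auto simp: graph_class_iff)
  define p where "p = domination_poly G - domination_poly H"
  have "num_dominating G (n - s) > num_dominating H (n - s)"
    using num_dominating_critical[OF fin(1) sG] num_dominating_critical[OF fin(2) sH] less n \<open>s < n\<close>
    by simp
  then have pos: "coeff p (n - s) > 0"
    using \<open>s < n\<close> n by (simp add: p_def coeff_domination_poly)
  \<comment> \<open>For j \<le> n, write j as \<open>n - (n - j)\<close> with
    \<open>n - j < s\<close>, so that both counts are the full binomial coefficient.\<close>
  have "coeff p j = 0" if "j > n - s" for j
  proof (cases "j \<le> n")
    case True
    then have "num_dominating G (n - (n - j)) = num_dominating H (n - (n - j))"
      using num_dominating_large[OF fin(1) sG, of "n - j"]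
        num_dominating_large[OF fin(2) sH, of "n - j"] that n \<open>s < n\<close> by simp
    with True show ?thesis by (simp add: p_def coeff_domination_poly n)
  qed (simp add: p_def coeff_domination_poly n)
  then have "degree p = n - s"
    using pos by (metis degree_le le_antisym le_degree less_irrefl)
  \<comment> \<open>With a positive leading coefficient, \<open>p\<close> is positive from some
    point on; \<open>max b 0\<close> moves this point into the range x \<ge> 0.\<close>
  then obtain b where b: "\<And>x. x \<ge> b \<Longrightarrow> poly p x \<ge> lead_coeff p"
    using poly_pinfty_gt_lc[of p] pos by auto
  then have "poly p (max b 0) > 0"
    using pos \<open>degree p = n - s\<close> by (metis max.cobounded1 order_less_le_trans)
  moreover have "poly p (max b 0) \<le> 0"
    unfolding p_def by (intro optimal_poly_diff_le[OF opt G]) simp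
  ultimately show False by simp
qed

lemma num_dominating_1:
  "num_dominating G 1 = card {v \<in> verts G. closed_nbhd G v = verts G}"
proof -
  have "bij_betw (\<lambda>v. {v}) {v \<in> verts G. closed_nbhd G v = verts G} {S. dominating G S \<and> card S = 1}"
  proof (rule bij_betw_imageI)
    show "(\<lambda>v. {v}) ` {v \<in> verts G. closed_nbhd G v = verts G} = {S. dominating G S \<and> card S = 1}"
      (is "?L = ?R")
    proof -
      have "dominating G {v} \<longleftrightarrow> v \<in> verts G \<and> closed_nbhd G v = verts G" for v
        by (auto simp: dominating_iff_closed_nbhd closed_nbhd_def insert_commute)
      then show ?thesis by (auto simp: card_1_singleton_iff)
    qed
  qed simp
  then show ?thesis unfolding num_dominating_def by (simp add: bij_betw_same_card)
qed

text \<open>Universal vertices are the dominating singletons, so they are counted by the coefficient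
  of x, the lowest one that can be nonzero, which decides for small positive x.\<close>

lemma optimal_universal_ge:
  fixes G H :: "'a sgraph"
  assumes opt: "optimal n m H" and G: "G \<in> graph_class n m" and "n \<ge> 1"
  shows "card {v \<in> verts G. closed_nbhd G v = verts G} \<le>
    card {v \<in> verts H. closed_nbhd H v = verts H}"
proof (rule ccontr)
  assume "\<not> ?thesis"
  then have less: "num_dominating H 1 < num_dominating G 1"
    by (simp only: num_dominating_1)
  have n: "card (verts G) = n" "card (verts H) = n"
    using G opt by (auto simp: graph_class_iff optimal_def)
  define p where "p = domination_poly G - domination_poly H"
  have "coeff p 0 = 0" by (simp add: p_def coeff_domination_poly)
  \<comment> \<open>Factoring out x turns the linear coefficient of \<open>p\<close> into the value
    of \<open>q\<close> at 0, so continuity makes \<open>q\<close> positive nearby.\<close>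
  then obtain q where q: "p = pCons 0 q" by (metis coeff_pCons_0 pCons_cases)
  have "coeff p 1 > 0"
    using less n \<open>n \<ge> 1\<close> by (simp add: p_def coeff_domination_poly)
  then have "poly q 0 > 0" by (simp add: q poly_0_coeff_0)
  moreover have "isCont (poly q) 0" by simp
  ultimately have "eventually (\<lambda>x. poly q x > 0) (at_right 0)"
    by (intro order_tendstoD(1)) (auto simp: continuous_at intro: tendsto_within_subset)
  moreover have "eventually (\<lambda>x::real. x > 0) (at_right 0)"
    by (simp add: eventually_at_right_less)
  ultimately have "eventually (\<lambda>x. poly p x > 0 \<and> x > 0) (at_right 0)"
    by eventually_elim (simp add: q)
  then obtain x where "poly p x > 0" "x > 0"
    using eventually_happens[of _ "at_right (0::real)"] by (auto simp: trivial_limit_at_right_real)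
  moreover have "poly p x \<le> 0"
    unfolding p_def using \<open>x > 0\<close> by (intro optimal_poly_diff_le[OF opt G]) simp
  ultimately show False by simp
qed

section \<open>Edge exchanges and degree sums\<close>

lemma exchange_edges_in_graph_class:
  assumes G: "G \<in> graph_class n m" and "R \<subseteq> edges G" "A \<inter> edges G = {}" "A \<subseteq> pairs (verts G)"
    and "card A = card R"
  shows "G\<lparr>edges := edges G - R \<union> A\<rparr> \<in> graph_class n m"
proof -
  have fin: "finite (edges G)" "finite A"
    using G assms(4) finite_pairs by (auto simp: graph_class_iff intro: finite_subset)
  then have "card (edges G - R \<union> A) = card (edges G - R) + card A"
    using assms by (intro card_Un_disjoint) auto
  also have "\<dots> = card (edges G)"
    using assms fin by (simp add: card_Diff_subset finite_subset card_mono)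
  finally show ?thesis using G assms by (auto simp: graph_class_iff)
qed

text \<open>Handshake lemma, by double counting the incidences between \<open>W\<close> and
  \<open>F\<close>.\<close>

lemma sum_degrees:
  assumes "finite W" "F \<subseteq> pairs W"
  shows "(\<Sum>x\<in>W. card {y \<in> W. {x, y} \<in> F}) = 2 * card F"
proof -
  have fin: "finite F" using assms finite_pairs finite_subset by blast
  have "card {y \<in> W. {x, y} \<in> F} = card {e \<in> F. x \<in> e}" if "x \<in> W" for x
  proof (rule bij_betw_same_card[of "\<lambda>y. {x, y}"], rule bij_betw_imageI)
    show "inj_on (\<lambda>y. {x, y}) {y \<in> W. {x, y} \<in> F}"
      by (auto simp: inj_on_def doubleton_eq_iff)
    show "(\<lambda>y. {x, y}) ` {y \<in> W. {x, y} \<in> F} = {e \<in> F. x \<in> e}"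
    proof (intro equalityI subsetI)
      fix e assume e: "e \<in> {e \<in> F. x \<in> e}"
      then have "card e = 2" "e \<subseteq> W" using assms by (auto simp: pairs_def)
      then obtain y where "e = {x, y}"
        using e by (auto simp: card_2_iff insert_commute)
      then show "e \<in> (\<lambda>y. {x, y}) ` {y \<in> W. {x, y} \<in> F}"
        using e \<open>e \<subseteq> W\<close> by auto
    qed auto
  qed
  then have "(\<Sum>x\<in>W. card {y \<in> W. {x, y} \<in> F}) = (\<Sum>x\<in>W. card {e \<in> F. x \<in> e})"
    by simp
  also have "\<dots> = (\<Sum>e\<in>F. card {x \<in> W. x \<in> e})"
    using sum.swap[of "\<lambda>x e. if x \<in> e then 1 else 0 :: nat" F W] assms(1) fin
    by (simp add: sum.If_cases Int_def)
  also have "\<dots> = (\<Sum>e\<in>F. 2)"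
  proof (rule sum.cong)
    fix e assume "e \<in> F"
    then have "e \<in> pairs W" using assms by auto
    then have "{x \<in> W. x \<in> e} = e" "card e = 2" by (auto simp: pairs_def)
    then show "card {x \<in> W. x \<in> e} = 2" by simp
  qed simp
  finally show ?thesis by simp
qed

section \<open>Universal vertices of an optimal graph and their complement\<close>

locale optimal_graph =
  fixes H :: "'a sgraph" and n m :: nat
  assumes opt: "optimal n m H" and n_le: "n - 1 \<le> m" and m_less: "m + 6 < n choose 2"
begin

abbreviation "V \<equiv> verts H"
abbreviation "E \<equiv> edges H"
abbreviation "cn \<equiv> closed_nbhd H"

definition "K = {v \<in> V. cn v = V}"
definition "W = V - K"
definition nb :: "'a \<Rightarrow> 'a set" where "nb x = {y \<in> W. {x, y} \<in> E}"
text \<open>The pairs forced to be edges because they contain a universal vertex; the remaining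
  edges are those inside \<open>W\<close>.\<close>

definition "PK = {e \<in> pairs V. e \<inter> K \<noteq> {}}"

lemma in_class: "H \<in> graph_class n m" using opt by (simp add: optimal_def)

lemma finV: "finite V" and E_sub: "E \<subseteq> pairs V" and cardV: "card V = n" and cardE: "card E = m"
  using in_class by (auto simp: graph_class_iff)

lemma finE: "finite E" using E_sub finite_pairs[OF finV] finite_subset by blast

lemma K_sub: "K \<subseteq> V" by (auto simp: K_def)
lemma finK: "finite K" using K_sub finV finite_subset by blast
lemma finW: "finite W" using finV by (simp add: W_def)
lemma W_sub: "W \<subseteq> V" by (auto simp: W_def)
lemma KW: "K \<inter> W = {}" by (auto simp: W_def)
lemma card_KW: "card K + card W = n"
  using card_Diff_subset[OF finK K_sub] card_mono[OF finV K_sub] by (simp add: W_def cardV)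

lemma n_pos: "n \<ge> 1" using m_less by (cases n) (auto simp: binomial_eq_0)

lemma edge_irrefl: "{x} \<notin> E" using E_sub by (auto simp: pairs_def)

lemma edge_K: "u \<in> K \<Longrightarrow> y \<in> V \<Longrightarrow> y \<noteq> u \<Longrightarrow> {u, y} \<in> E"
  by (auto simp: K_def closed_nbhd_def insert_commute)

lemma PK_sub: "PK \<subseteq> E"
proof
  fix e assume "e \<in> PK"
  then obtain u where "u \<in> K" "u \<in> e" "e \<subseteq> V" "card e = 2" by (auto simp: PK_def pairs_def)
  moreover then obtain y where "e = {u, y}" "y \<noteq> u" by (auto simp: card_2_iff insert_commute)
  ultimately show "e \<in> E" using edge_K by auto
qed

lemma card_edges_split: "m = card PK + card (E \<inter> pairs W)"
proof -
  have "E = PK \<union> (E \<inter> pairs W)"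
    using PK_sub E_sub by (auto simp: PK_def pairs_def W_def)
  moreover have "PK \<inter> (E \<inter> pairs W) = {}" by (auto simp: PK_def pairs_def W_def)
  ultimately show ?thesis
    using card_Un_disjoint[of PK "E \<inter> pairs W"] finE PK_sub finite_subset cardE by (metis finite_Int)
qed

lemma card_pairs_split: "n choose 2 = card PK + (card W choose 2)"
proof -
  have "pairs V = PK \<union> pairs W" by (auto simp: PK_def pairs_def W_def)
  moreover have "PK \<inter> pairs W = {}" by (auto simp: PK_def pairs_def W_def)
  ultimately show ?thesis
    using card_Un_disjoint[of PK "pairs W"] finite_pairs[OF finV] finite_pairs[OF finW]
      card_pairs[OF finV] card_pairs[OF finW] cardV by simp
qed

text \<open>All non-adjacent pairs lie inside \<open>W\<close>. There are more than 6 of them, while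
  four vertices span only 6 pairs.\<close>

lemma card_W_ge: "card W \<ge> 5"
proof (rule ccontr)
  assume "\<not> ?thesis"
  then have "card W \<le> 4" by simp
  then have "card W choose 2 \<le> 4 choose 2" by (rule binomial_right_mono)
  moreover have "(4::nat) choose 2 = 6" by (simp add: choose_two)
  ultimately show False using m_less card_edges_split card_pairs_split by simp
qed

text \<open>Making some \<open>z\<close> in \<open>W\<close> universal as well costs at most
  \<open>card W - 1\<close> edges beyond \<open>PK\<close>. With that many edges inside
  \<open>W\<close>, a competitor with more universal vertices exists.\<close>

lemma few_edges_in_W: "card (E \<inter> pairs W) + 2 \<le> card W"
proof (rule ccontr)
  assume "\<not> ?thesis"
  then have many: "card W \<le> card (E \<inter> pairs W) + 1" by simp
  obtain z where z: "z \<in> W" using card_W_ge by fastforce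
  define P where "P = {e \<in> pairs V. e \<inter> insert z K \<noteq> {}}"
  have "P \<subseteq> PK \<union> (\<lambda>y. {z, y}) ` (W - {z})"
  proof
    fix e assume e: "e \<in> P"
    show "e \<in> PK \<union> (\<lambda>y. {z, y}) ` (W - {z})"
    proof (cases "e \<in> PK")
      case False
      with e have "z \<in> e" "e \<inter> K = {}" "card e = 2" "e \<subseteq> V" by (auto simp: P_def PK_def pairs_def)
      moreover then obtain y where "e = {z, y}" "y \<noteq> z" by (auto simp: card_2_iff insert_commute)
      ultimately show ?thesis by (auto simp: W_def)
    qed simp
  qed
  then have "card P \<le> card (PK \<union> (\<lambda>y. {z, y}) ` (W - {z}))"
    using finW finE PK_sub finite_subset by (intro card_mono) auto
  also have "\<dots> \<le> card PK + card (W - {z})"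
    using card_Un_le card_image_le[of "W - {z}" "\<lambda>y. {z, y}"] finW
    by (meson add_left_mono finite_Diff le_trans)
  also have "\<dots> \<le> m" using many card_edges_split z finW by simp
  finally have "card P \<le> m" .
  moreover have "m \<le> card (pairs V)" using card_mono[OF finite_pairs[OF finV] E_sub] cardE by simp
  moreover have "P \<subseteq> pairs V" by (auto simp: P_def)
  \<comment> \<open>\<open>P\<close> holds the edges that make \<open>insert z K\<close> universal;
    arbitrary further pairs bring the number of edges to exactly \<open>m\<close>.\<close>
  ultimately obtain F where F: "P \<subseteq> F" "F \<subseteq> pairs V" "card F = m"
    using exists_subset_between[of P m "pairs V"] finite_pairs[OF finV] by blast
  define G where "G = \<lparr>verts = V, edges = F\<rparr>"
  have "G \<in> graph_class n m" using F finV cardV by (simp add: G_def graph_class_iff)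
  then have "card {v \<in> verts G. closed_nbhd G v = verts G} \<le> card K"
    using optimal_universal_ge[OF opt _ n_pos] by (simp add: K_def)
  moreover have "insert z K \<subseteq> {v \<in> verts G. closed_nbhd G v = verts G}"
  proof
    fix v assume v: "v \<in> insert z K"
    then have "v \<in> V" using z K_sub W_sub by auto
    moreover have "{y, v} \<in> F" if "y \<in> V" "y \<noteq> v" for y
    proof -
      have "{y, v} \<in> P" using v that \<open>v \<in> V\<close> by (auto simp: P_def doubleton_in_pairs)
      then show ?thesis using F by auto
    qed
    ultimately show "v \<in> {v \<in> verts G. closed_nbhd G v = verts G}"
      by (auto simp: G_def closed_nbhd_def)
  qed
  then have "card (insert z K) \<le> card {v \<in> verts G. closed_nbhd G v = verts G}"
    using finV by (intro card_mono) (auto simp: G_def)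
  moreover have "card (insert z K) = card K + 1" using z finK by (simp add: W_def)
  ultimately show False by simp
qed

text \<open>Otherwise \<open>W\<close> is all of \<open>V\<close> and \<open>few_edges_in_W\<close>
  gives m + 2 \<le> n, against \<open>n_le\<close>.\<close>

lemma K_nonempty: "K \<noteq> {}"
proof
  assume "K = {}"
  then have "W = V" "PK = {}" by (auto simp: W_def PK_def)
  then show False using few_edges_in_W card_edges_split n_le cardV by simp
qed

section \<open>Degrees inside \<open>W\<close> and the exchange of one edge\<close>

lemma nb_sub: "nb x \<subseteq> W" and nb_irrefl: "x \<notin> nb x" and nb_sym: "x \<in> W \<Longrightarrow> y \<in> nb x \<Longrightarrow> x \<in> nb y"
  using edge_irrefl by (auto simp: nb_def insert_commute)

lemma fin_nb: "finite (nb x)" using nb_sub finW finite_subset by blast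

lemma cn_W: "x \<in> W \<Longrightarrow> cn x = K \<union> insert x (nb x)"
  using edge_K[of _ x] K_sub by (auto simp: closed_nbhd_def nb_def W_def insert_commute)

lemma cn_K: "x \<in> K \<Longrightarrow> cn x = V" by (simp add: K_def)

lemma card_cn_W: assumes "x \<in> W" shows "card (cn x) = card K + 1 + card (nb x)"
proof -
  have "card (K \<union> insert x (nb x)) = card K + card (insert x (nb x))"
    using assms KW nb_sub finK fin_nb by (intro card_Un_disjoint) auto
  then show ?thesis using assms nb_irrefl fin_nb by (simp add: cn_W)
qed

lemma sum_nb: "(\<Sum>x\<in>W. card (nb x)) + 4 \<le> 2 * card W"
proof -
  have "nb x = {y \<in> W. {x, y} \<in> E \<inter> pairs W}" if "x \<in> W" for x
    using that E_sub by (auto simp: nb_def pairs_def)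
  then have "(\<Sum>x\<in>W. card (nb x)) = 2 * card (E \<inter> pairs W)"
    using sum_degrees[OF finW, of "E \<inter> pairs W"] by simp
  then show ?thesis using few_edges_in_W by simp
qed

text \<open>Vertices with equal closed neighbourhoods are adjacent. Used to show that small closed
  neighbourhoods belong to one vertex only.\<close>

lemma inj_cn_W:
  assumes "x \<in> W" "y \<in> V" "cn y = cn x" "y \<noteq> x"
  shows "y \<in> nb x"
proof -
  have "y \<in> cn x" using assms by (auto simp: closed_nbhd_def)
  moreover have "y \<notin> K"
  proof
    assume "y \<in> K"
    then have "cn x = V" using assms cn_K by simp
    then show False using assms by (auto simp: W_def K_def)
  qed
  ultimately show ?thesis using assms by (auto simp: cn_W)
qed

text \<open>Replacing the edge \<open>{u, w}\<close> by \<open>{v, w}\<close> raises the size at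
  \<open>v\<close> to \<open>s + 1\<close>, keeps the size at \<open>w\<close>, and leaves
  \<open>u\<close> with \<open>n - 1\<close>, still above \<open>s\<close>. The set
  \<open>cn v\<close> is lost because only \<open>v\<close> has it; any new set at \<open>w\<close>
  is offset by the loss of \<open>cn w\<close>. So the number of sets of size \<open>s\<close>
  drops.\<close>

lemma move_edge:
  assumes u: "u \<in> K" and v: "v \<in> W" and w: "w \<in> W" and vw: "v \<noteq> w" "{v, w} \<notin> E"
    and sv: "card (cn v) = s" and s_le: "\<forall>x\<in>V. s \<le> card (cn x)" and s_less: "s + 1 < n"
    and v_unsh: "\<And>x. x \<in> V \<Longrightarrow> card (cn x) = s \<Longrightarrow> cn x = cn v \<Longrightarrow> x = v"
    and w_unsh: "\<And>x. x \<in> V \<Longrightarrow> card (cn x) = s \<Longrightarrow> cn x = cn w \<Longrightarrow> x = w"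
  shows False
proof -
  define G where "G = H\<lparr>edges := E - {{u, w}} \<union> {{v, w}}\<rparr>"
  have ne: "u \<noteq> v" "u \<noteq> w" using u v w KW by auto
  have inV: "u \<in> V" "v \<in> V" "w \<in> V" using u v w K_sub W_sub by auto
  have uw: "{u, w} \<in> E" using edge_K u inV ne by auto
  have "G \<in> graph_class n m" unfolding G_def
    using exchange_edges_in_graph_class[OF in_class, of "{{u, w}}" "{{v, w}}"] uw vw inV
    by (simp add: doubleton_in_pairs)
  let ?g = "closed_nbhd G"
  have other: "?g x = cn x" if "x \<notin> {u, v, w}" for x
    using that by (auto simp: G_def closed_nbhd_def doubleton_eq_iff)
  have gu: "?g u = V - {w}"
    using ne vw inV cn_K[OF u] by (auto simp: G_def closed_nbhd_def doubleton_eq_iff)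
  have gv: "?g v = insert w (cn v)"
    using ne vw inV by (auto simp: G_def closed_nbhd_def doubleton_eq_iff insert_commute)
  have gw: "?g w = insert v (cn w - {u})"
    using ne vw inV by (auto simp: G_def closed_nbhd_def doubleton_eq_iff)
  have fincn: "finite (cn x)" for x using closed_nbhd_subset finV finite_subset by metis
  have cu: "card (?g u) = n - 1" using gu inV finV cardV by simp
  have "w \<notin> cn v" using vw by (auto simp: closed_nbhd_def insert_commute)
  then have cv: "card (?g v) = s + 1" using gv fincn sv by simp
  have "v \<notin> cn w" "u \<in> cn w" using vw uw inV by (auto simp: closed_nbhd_def insert_commute)
  then have cw: "card (?g w) = card (cn w)"
    using gw fincn card_Suc_Diff1[of "cn w" u] by simp
  define S where "S = {x \<in> V. card (cn x) = s} - {v}"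
  have vG: "verts G = V" by (simp add: G_def)
  have cn_u: "card (cn u) = n" using cn_K u cardV by simp
  have SG: "{x \<in> verts G. card (?g x) = s} = S"
  proof (rule set_eqI)
    fix y
    consider "y = u" | "y = v" | "y = w" | "y \<notin> {u, v, w}" by blast
    then show "y \<in> {x \<in> verts G. card (?g x) = s} \<longleftrightarrow> y \<in> S"
    proof cases
      case 1
      then show ?thesis using cu cn_u s_less by (auto simp: S_def)
    next
      case 2
      then show ?thesis using cv by (simp add: S_def)
    next
      case 3
      then show ?thesis using cw vw by (auto simp: S_def vG)
    next
      case 4
      then show ?thesis using other[OF 4] by (auto simp: S_def vG)
    qed
  qed
  have finS: "finite S" using finV by (simp add: S_def)
  \<comment> \<open>On \<open>S\<close> only \<open>w\<close> can change its closed neighbourhood.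
    If it does, at most one set is gained, and \<open>cn w\<close> is lost since no other vertex of
    \<open>S\<close> has it.\<close>
  have "card (?g ` S) \<le> card (cn ` S)"
  proof (cases "w \<in> S")
    case False
    have "?g x = cn x" if "x \<in> S" for x
      using that False other cn_u s_less by (intro other) (auto simp: S_def)
    then show ?thesis by simp
  next
    case True
    have "?g x = cn x" if "x \<in> S - {w}" for x
      using that other cn_u s_less by (intro other) (auto simp: S_def)
    then have im: "?g ` (S - {w}) = cn ` (S - {w})" by simp
    have "?g ` S = insert (?g w) (cn ` (S - {w}))" using True im by blast
    then have "card (?g ` S) \<le> card (cn ` (S - {w})) + 1"
      using card_insert_if[of "cn ` (S - {w})" "?g w"] finS by auto
    moreover have "cn w \<notin> cn ` (S - {w})" using w_unsh by (auto simp: S_def)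
    moreover have "cn ` S = insert (cn w) (cn ` (S - {w}))" using True by blast
    ultimately show ?thesis using finS by simp
  qed
  moreover have "small_nbhds H s = insert (cn v) (cn ` S)"
    using sv inV by (auto simp: small_nbhds_def S_def)
  moreover have "cn v \<notin> cn ` S" using v_unsh by (auto simp: S_def)
  moreover have "small_nbhds G s = ?g ` S" unfolding small_nbhds_def SG ..
  ultimately have "card (small_nbhds G s) < card (small_nbhds H s)" using finS by simp
  moreover have "\<forall>x\<in>verts G. s \<le> card (?g x)"
  proof
    fix y assume "y \<in> verts G"
    then have "s \<le> card (cn y)" using s_le by (simp add: vG)
    then show "s \<le> card (?g y)"
      using other[of y] cu cv cw s_less by (cases "y \<in> {u, v, w}") auto
  qed
  ultimately show False
    using optimal_small_nbhds_le[OF opt \<open>G \<in> graph_class n m\<close> _ _ s_le] s_less by simp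
qed

text \<open>A vertex isolated inside \<open>W\<close> attains the least possible size
  \<open>card K + 1\<close>, and vertices of that size have no neighbour in \<open>W\<close> to
  share it with. So \<open>move_edge\<close> applies with any other \<open>w\<close> in
  \<open>W\<close>.\<close>

lemma nb_nonempty: assumes "v \<in> W" shows "nb v \<noteq> {}"
proof
  assume nb: "nb v = {}"
  obtain u where u: "u \<in> K" using K_nonempty by auto
  have "card (W - {v}) \<ge> 4" using card_W_ge assms finW by simp
  then have "W - {v} \<noteq> {}" by (metis card.empty not_numeral_le_zero)
  then obtain w where w: "w \<in> W" "w \<noteq> v" by auto
  show False
  proof (rule move_edge[of u v w "card K + 1"])
    show "{v, w} \<notin> E" using nb w by (auto simp: nb_def)
    show "card (cn v) = card K + 1" using card_cn_W[OF assms] nb by simp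
    show "\<forall>x\<in>V. card K + 1 \<le> card (cn x)"
      using card_cn_W cn_K cardV card_KW card_W_ge by (force simp: W_def)
    show "card K + 1 + 1 < n" using card_KW card_W_ge by simp
    show "x = v" if "x \<in> V" "card (cn x) = card K + 1" "cn x = cn v" for x
      using inj_cn_W[OF assms that(1,3)] nb by auto
    show "x = w" if "x \<in> V" "card (cn x) = card K + 1" "cn x = cn w" for x
      using inj_cn_W[OF w(1) that(1,3)] card_cn_W[OF w(1)] that fin_nb by auto
  qed (use u w assms in auto)
qed

section \<open>Leaves inside \<open>W\<close> and the contradiction\<close>

lemma card_nb_pos: "x \<in> W \<Longrightarrow> card (nb x) \<ge> 1"
  using nb_nonempty fin_nb by (simp add: Suc_le_eq card_gt_0_iff)

lemma card_cn_ge: "\<forall>x\<in>V. card K + 2 \<le> card (cn x)"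
  using card_cn_W card_nb_pos cn_K cardV card_KW card_W_ge by (force simp: W_def)

text \<open>If \<open>v'\<close> had a second neighbour \<open>w\<close>, then
  \<open>move_edge\<close> could join \<open>v\<close> to \<open>w\<close> with
  \<open>s = card K + 2\<close>, the size at a leaf.\<close>

lemma leaf_neighbour:
  assumes "v \<in> W" "nb v = {v'}" shows "nb v' = {v}"
proof (rule ccontr)
  assume nv': "nb v' \<noteq> {v}"
  have v': "v' \<in> W" "v \<in> nb v'" using assms nb_sub nb_sym by auto
  then obtain w where w: "w \<in> nb v'" "w \<noteq> v" using nv' by auto
  then have wW: "w \<in> W" using nb_sub by auto
  have "card {v, w} \<le> card (nb v')" using v' w fin_nb by (intro card_mono) auto
  then have cv': "card (nb v') \<ge> 2" using w by simp
  obtain u where u: "u \<in> K" using K_nonempty by auto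
  \<comment> \<open>Here \<open>y\<close> is a leaf attached to \<open>v'\<close>, so another vertex
    with the same closed neighbourhood would be \<open>v'\<close> itself, whose degree inside
    \<open>W\<close> is at least 2.\<close>
  have unsh: "x = y" if "y \<in> W" "v' \<in> nb y" "x \<in> V" "card (cn x) = card K + 2" "cn x = cn y" for x y
  proof (rule ccontr)
    assume "x \<noteq> y"
    then have "x \<in> nb y" using inj_cn_W that by auto
    have "card (nb y) = 1" using card_cn_W[OF that(1)] that by simp
    then have "x = v'" using that \<open>x \<in> nb y\<close> by (metis card_1_singletonE singletonD)
    then show False using card_cn_W[OF v'(1)] cv' that by simp
  qed
  show False
  proof (rule move_edge[of u v w "card K + 2"])
    show "{v, w} \<notin> E" 
    proof
      assume "{v, w} \<in> E"
      then have "w \<in> nb v" using wW by (simp add: nb_def)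
      then show False using assms(2) w nb_irrefl[of v'] by simp
    qed
    show "card (cn v) = card K + 2" using card_cn_W[OF assms(1)] assms by simp
    show "card K + 2 + 1 < n" using card_KW card_W_ge by simp
    show "x = v" if "x \<in> V" "card (cn x) = card K + 2" "cn x = cn v" for x
      using unsh[OF assms(1)] assms that by simp
    show "x = w" if "x \<in> V" "card (cn x) = card K + 2" "cn x = cn w" for x
      using unsh[OF wW] w nb_sym[OF v'(1)] that by simp
  qed (use u wW w assms card_cn_ge in auto)
qed

lemma many_leaves: "card {x \<in> W. card (nb x) = 1} \<ge> 4"
proof -
  let ?L = "{x \<in> W. card (nb x) = 1}"
  \<comment> \<open>Since no degree is 0, only leaves fall short of degree 2, each by one; the
    degree sum falls short of \<open>2 * card W\<close> by at least 4.\<close>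
  have "(\<Sum>x\<in>W. (2::nat)) \<le> (\<Sum>x\<in>W. card (nb x) + (if card (nb x) = 1 then 1 else 0))"
    using card_nb_pos by (intro sum_mono) force
  also have "\<dots> = (\<Sum>x\<in>W. card (nb x)) + card ?L"
    using finW by (simp add: sum.distrib sum.If_cases Int_def)
  finally show ?thesis using sum_nb by simp
qed

text \<open>Two \<open>K\<^sub>2\<close> components contribute two sets of size
  \<open>card K + 2\<close>. After the exchange their four vertices contribute at most one, that of
  \<open>x'\<close>.\<close>

lemma two_matching_edges:
  assumes W: "w \<in> W" "x \<in> W" and nb: "nb w = {w'}" "nb w' = {w}" "nb x = {x'}" "nb x' = {x}"
    and dist: "distinct [w, w', x, x']" and six: "card W \<ge> 6"
  shows False
proof -
  obtain u where u: "u \<in> K" using K_nonempty by auto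
  have W': "w' \<in> W" "x' \<in> W" using nb nb_sub by blast+
  have inV: "u \<in> V" "w \<in> V" "w' \<in> V" "x \<in> V" "x' \<in> V" using u W W' W_sub K_sub by auto
  have ne: "u \<noteq> w" "u \<noteq> w'" "u \<noteq> x" "u \<noteq> x'" using u W W' KW by auto
  have ne2: "w \<noteq> w'" "w \<noteq> x" "w \<noteq> x'" "w' \<noteq> x" "w' \<noteq> x'" "x \<noteq> x'" using dist by auto
  have cns: "cn w = K \<union> {w, w'}" "cn w' = K \<union> {w, w'}" "cn x = K \<union> {x, x'}" "cn x' = K \<union> {x, x'}"
    using cn_W W W' nb by auto
  \<comment> \<open>Adding \<open>A\<close> yields \<open>K\<^sub>4\<close> without the edge between
    \<open>w'\<close> and \<open>x'\<close>. Losing \<open>u\<close> brings the closed neighbourhood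
    of \<open>x'\<close> back to the critical size, while those of \<open>w\<close>,
    \<open>x\<close> and \<open>w'\<close> end at \<open>card K + 3\<close>.\<close>
  define R where "R = {{u, w}, {u, x}, {u, x'}}"
  define A where "A = {{w, x}, {w, x'}, {w', x}}"
  define G where "G = H\<lparr>edges := E - R \<union> A\<rparr>"
  have nE: "{w, x} \<notin> E" "{w, x'} \<notin> E" "{w', x} \<notin> E"
    using nb W W' ne2 by (auto simp: nb_def)
  have "card R = 3" "card A = 3" using ne ne2 by (auto simp: R_def A_def doubleton_eq_iff)
  then have "G \<in> graph_class n m" unfolding G_def
    using nE ne ne2 inV u edge_K
    by (intro exchange_edges_in_graph_class[OF in_class])
      (auto simp: R_def A_def doubleton_in_pairs)
  let ?g = "closed_nbhd G"
  have vG: "verts G = V" by (simp add: G_def)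
  have mem: "y \<in> ?g z \<longleftrightarrow> y \<in> V \<and> (y = z \<or> {y, z} \<in> A \<or> y \<in> cn z \<and> {y, z} \<notin> R)"
    for y z using edge_irrefl by (auto simp: G_def closed_nbhd_def R_def)
  have memA: "{y, z} \<in> A \<longleftrightarrow> y = w \<and> z = x \<or> y = x \<and> z = w \<or> y = w \<and> z = x' \<or> y = x' \<and> z = w
      \<or> y = w' \<and> z = x \<or> y = x \<and> z = w'" for y z
    by (auto simp: A_def doubleton_eq_iff)
  have memR: "{y, z} \<in> R \<longleftrightarrow> y = u \<and> z \<in> {w, x, x'} \<or> z = u \<and> y \<in> {w, x, x'}" for y z
    by (auto simp: R_def doubleton_eq_iff)
  have other: "?g y = cn y" if "y \<notin> {u, w, w', x, x'}" for y
    using that closed_nbhd_subset[of H y] unfolding set_eq_iff mem memA memR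
    by (auto simp: closed_nbhd_def[of H])
  have gu: "?g u = V - {w, x, x'}"
    using ne ne2 inV cn_K[OF u] unfolding set_eq_iff mem memA memR by auto
  have gw: "?g w = (K - {u}) \<union> {w, w', x, x'}"
    using ne ne2 inV K_sub unfolding set_eq_iff mem memA memR cns by auto
  have gw': "?g w' = K \<union> {w, w', x}"
    using ne ne2 inV K_sub unfolding set_eq_iff mem memA memR cns by auto
  have gx: "?g x = (K - {u}) \<union> {w, w', x, x'}"
    using ne ne2 inV K_sub unfolding set_eq_iff mem memA memR cns by auto
  have notK: "w \<notin> K" "w' \<notin> K" "x \<notin> K" "x' \<notin> K" using W W' KW by auto
  have gx': "?g x' = (K - {u}) \<union> {w, x, x'}"
    using ne ne2 inV K_sub unfolding set_eq_iff mem memA memR cns by auto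
  let ?s = "card K + 2"
  have Kpos: "card K \<ge> 1" using u finK by (simp add: Suc_le_eq card_gt_0_iff) auto
  have "card (V - {w, x, x'}) = n - 3"
    using inV ne2 finV cardV by (subst card_Diff_subset) auto
  \<comment> \<open>The vertex \<open>u\<close> loses three neighbours, and n - 3 exceeds
    \<open>card K + 2\<close> precisely because \<open>W\<close> has at least six vertices.\<close>
  then have cu: "card (?g u) > ?s" using gu card_KW six by simp
  have cw: "card (?g w) > ?s" "card (?g x) > ?s"
    unfolding gw gx using finK notK ne2 u Kpos by auto
  have cw': "card (?g w') > ?s" unfolding gw' using finK notK ne2 by auto
  have cx': "card (?g x') = ?s" unfolding gx' using finK notK ne2 u Kpos by auto
  define S where "S = {y \<in> V. card (cn y) = ?s} - {w, w', x, x'}"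
  have finS: "finite S" using finV by (simp add: S_def)
  have cn_u: "card (cn u) > ?s" using cn_K u cardV card_KW six by simp
  have sub: "small_nbhds G ?s \<subseteq> insert (?g x') (cn ` S)"
  proof
    fix N assume "N \<in> small_nbhds G ?s"
    then obtain y where y: "N = ?g y" "y \<in> V" "card (?g y) = ?s" by (auto simp: small_nbhds_def vG)
    then have "y \<notin> {u, w, w', x}" using cu cw cw' by auto
    then show "N \<in> insert (?g x') (cn ` S)"
      using y other[of y] by (cases "y = x'") (auto simp: S_def)
  qed
  have "card (cn w) = ?s" "card (cn x) = ?s" using card_cn_W W nb by simp_all
  then have "insert (cn w) (insert (cn x) (cn ` S)) \<subseteq> small_nbhds H ?s"
    using inV by (auto simp: small_nbhds_def S_def)
  then have "card (insert (cn w) (insert (cn x) (cn ` S))) \<le> card (small_nbhds H ?s)"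
    using finV by (intro card_mono) (auto simp: small_nbhds_def)
  moreover have "card (small_nbhds G ?s) \<le> card (cn ` S) + 1"
    using card_mono[OF _ sub] card_insert_if[of "cn ` S" "?g x'"] finS by (auto split: if_splits)
  moreover have "cn x \<notin> cn ` S" "cn w \<notin> cn ` S"
    using inj_cn_W[OF W(1)] inj_cn_W[OF W(2)] nb by (auto simp: S_def)
  moreover have "cn w \<noteq> cn x" using cns notK ne2 by auto
  ultimately have "card (small_nbhds G ?s) < card (small_nbhds H ?s)" using finS by simp
  moreover have "\<forall>y\<in>verts G. ?s \<le> card (?g y)"
  proof
    fix y assume "y \<in> verts G"
    then have "?s \<le> card (cn y)" using card_cn_ge by (simp add: vG)
    then show "?s \<le> card (?g y)"
      using other[of y] cu cw cw' cx' by (cases "y \<in> {u, w, w', x, x'}") auto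
  qed
  moreover have "?s < n" using card_KW six by simp
  ultimately show False
    using optimal_small_nbhds_le[OF opt \<open>G \<in> graph_class n m\<close> _ _ card_cn_ge] by simp
qed

lemma absurd: False
proof -
  let ?L = "{x \<in> W. card (nb x) = 1}"
  have L4: "card ?L \<ge> 4" by (rule many_leaves)
  have finL: "finite ?L" using finW by simp
  have "?L \<noteq> {}" using L4 by (metis card.empty not_numeral_le_zero)
  then obtain w where w: "w \<in> W" "card (nb w) = 1" by auto
  then obtain w' where w': "nb w = {w'}" by (auto simp: card_1_singleton_iff)
  have nw': "nb w' = {w}" by (rule leaf_neighbour[OF w(1) w'])
  have "\<not> ?L \<subseteq> {w, w'}"
    using L4 card_mono[of "{w, w'}" ?L] by (auto simp: card_insert_if split: if_splits)
  then obtain x where x: "x \<in> W" "card (nb x) = 1" "x \<noteq> w" "x \<noteq> w'" by auto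
  then obtain x' where x': "nb x = {x'}" by (auto simp: card_1_singleton_iff)
  have nx': "nb x' = {x}" by (rule leaf_neighbour[OF x(1) x'])
  have d: "distinct [w, w', x, x']" using w' nw' x' nx' x nb_irrefl[of w] nb_irrefl[of x] by auto
  \<comment> \<open>A fifth vertex of \<open>W\<close> has a neighbour in \<open>W\<close>, which
    cannot be among the four matched ones; this supplies the sixth vertex.\<close>
  have "\<not> W \<subseteq> {w, w', x, x'}"
    using card_W_ge card_mono[of "{w, w', x, x'}" W] d by auto
  then obtain y where y: "y \<in> W" "y \<notin> {w, w', x, x'}" by auto
  then obtain z where z: "z \<in> nb y" using nb_nonempty by auto
  then have "y \<in> nb z" "z \<in> W" using nb_sym y nb_sub by auto
  then have zz: "z \<notin> {w, w', x, x', y}" using w' nw' x' nx' y nb_irrefl[of y] by auto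
  have "card {w, w', x, x', y, z} \<le> card W"
    using w w' x x' y \<open>z \<in> W\<close> nb_sub finW by (intro card_mono) auto
  moreover have "card {w, w', x, x', y, z} = 6" using d y zz by auto
  ultimately have "card W \<ge> 6" by simp
  then show False using two_matching_edges[OF w(1) x(1) w' nw' x' nx' d] by simp
qed

end

theorem theorem2p12:
  fixes n m :: nat
  assumes "n \<ge> 6" and "n - 1 \<le> m" and "m < (n choose 2) - 6"
  shows "\<not> (\<exists>H :: nat sgraph. optimal n m H)"
proof
  assume "\<exists>H :: nat sgraph. optimal n m H"
  then obtain H :: "nat sgraph" where "optimal n m H" ..
  then interpret optimal_graph H n m
    using assms by unfold_locales auto
  show False by (rule absurd)
qed

end
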